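(* Let $\mathbf{A}\in\mathbb{R}^{m\times n}$, $\boldsymbol{b}\in\mathbb{R}^m$, and let $\mathbf{W}=\mathbf{D}^{-1}\mathbf{K}\in\mathbb{R}^{n\times n}$ be a kernel denoiser. For $\lambda>0$, let $f:\mathbb{R}^n\to(-\infty,\infty]$ be $$f(\boldsymbol{x})=\ell_{\mathbf{A}}(\boldsymbol{x})+\lambda\,\phi_{\mathbf{W}}(\boldsymbol{x}),\qquad \ell_{\mathbf{A}}(\boldsymbol{x})=\tfrac12\|\mathbf{A}\boldsymbol{x}-\boldsymbol{b}\|_2^2,$$ where $\phi_{\mathbf{W}}$ is the regularizer associated with $\mathbf{W}$. Then $f$ is strongly convex on $(\mathbb{R}^n,\langle\cdot,\cdot\rangle_{\mathbf{D}})$ if and only if $\mathcal{N}(\mathbf{A})\cap\mathrm{fix}(\mathbf{W})=\{\mathbf{0}\}$.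
   Context: A kernel denoiser is a matrix $\mathbf{W}=\mathbf{D}^{-1}\mathbf{K}$, where $\mathbf{K}\in\mathbb{R}^{n\times n}$ is symmetric positive semidefinite, entrywise nonnegative, with positive diagonal entries, and $\mathbf{D}=\mathrm{diag}(\mathbf{K}\boldsymbol{e})$ with $\boldsymbol{e}$ the all-ones vector. Put $\mathbf{W}_s=\mathbf{D}^{-1/2}\mathbf{K}\mathbf{D}^{-1/2}$, which is symmetric with spectrum in $[0,1]$, and $$\varphi_{\mathbf{W}_s}(\boldsymbol{x})=\tfrac12\boldsymbol{x}^\top\mathbf{W}_s^{\dagger}(\mathbf{I}-\mathbf{W}_s)\boldsymbol{x}+\iota_{\mathcal{R}(\mathbf{W}_s)}(\boldsymbol{x}),\qquad \phi_{\mathbf{W}}(\boldsymbol{x})=\varphi_{\mathbf{W}_s}(\mathbf{D}^{1/2}\boldsymbol{x}).$$ Here $^\dagger$ is the Moore–Penrose pseudoinverse, $\mathcal{N},\mathcal{R}$ denote null space and range, $\mathrm{fix}(\mathbf{W})=\{\boldsymbol{x}:\mathbf{W}\boldsymbol{x}=\boldsymbol{x}\}$, and $\iota_\Omega$ is $0$ on $\Omega$ and $+\infty$ off $\Omega$. The inner product is $\langle\boldsymbol{x},\boldsymbol{y}\rangle_{\mathbf{D}}=\boldsymbol{x}^\top\mathbf{D}\boldsymbol{y}$. A proper, closed, convex function $f:\mathbb{R}^n\to(-\infty,\infty]$ is strongly convex on a Euclidean space $(\mathbb{R}^n,\langle\cdot,\cdot\rangle)$ with induced norm $\|\cdot\|$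 if there exists $\mu>0$ such that for all $\boldsymbol{x},\boldsymbol{y}\in\mathbb{R}^n$ and $\theta\in[0,1]$, $$f(\theta\boldsymbol{x}+(1-\theta)\boldsymbol{y})\le\theta f(\boldsymbol{x})+(1-\theta)f(\boldsymbol{y})-\tfrac{\mu}{2}\theta(1-\theta)\|\boldsymbol{x}-\boldsymbol{y}\|^2.$$ *)

theory Defs
  imports "HOL-Analysis.Analysis"
begin

definition diag_mat :: "real ^ 'n \<Rightarrow> real ^ 'n ^ 'n" where
  "diag_mat v = (\<chi> i j. if i = j then v $ i else 0)"

definition psd_matrix :: "real ^ 'n ^ 'n \<Rightarrow> bool" where
  "psd_matrix M \<longleftrightarrow> transpose M = M \<and> (\<forall>x. 0 \<le> x \<bullet> (M *v x))"

(* The Moore-Penrose pseudoinverse is the unique solution of the four Penrose equations. *)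
definition is_pinv :: "real ^ 'n ^ 'm \<Rightarrow> real ^ 'm ^ 'n \<Rightarrow> bool" where
  "is_pinv M X \<longleftrightarrow>
     M ** X ** M = M \<and> X ** M ** X = X \<and>
     transpose (M ** X) = M ** X \<and> transpose (X ** M) = X ** M"

definition pinv :: "real ^ 'n ^ 'm \<Rightarrow> real ^ 'm ^ 'n" where
  "pinv M = (THE X. is_pinv M X)"

definition kernel_matrix :: "real ^ 'n ^ 'n \<Rightarrow> bool" where
  "kernel_matrix K \<longleftrightarrow>
     psd_matrix K \<and> (\<forall>i j. 0 \<le> K $ i $ j) \<and> (\<forall>i. 0 < K $ i $ i)"

(* The objects D, D^(1/2), W, W_s and phi_W are all functions of K rather than of
   W = D^(-1) K: different kernel matrices can give the same W but different D. *)

definition row_sums :: "real ^ 'n ^ 'n \<Rightarrow> real ^ 'n" where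
  "row_sums K = K *v (\<chi> i. 1)"

definition deg_mat :: "real ^ 'n ^ 'n \<Rightarrow> real ^ 'n ^ 'n" where
  "deg_mat K = diag_mat (row_sums K)"

definition sqrt_deg_mat :: "real ^ 'n ^ 'n \<Rightarrow> real ^ 'n ^ 'n" where
  "sqrt_deg_mat K = diag_mat (\<chi> i. sqrt (row_sums K $ i))"

definition kernel_denoiser :: "real ^ 'n ^ 'n \<Rightarrow> real ^ 'n ^ 'n" where
  "kernel_denoiser K = matrix_inv (deg_mat K) ** K"

definition sym_denoiser :: "real ^ 'n ^ 'n \<Rightarrow> real ^ 'n ^ 'n" where
  "sym_denoiser K = matrix_inv (sqrt_deg_mat K) ** K ** matrix_inv (sqrt_deg_mat K)"

definition null_space :: "real ^ 'n ^ 'm \<Rightarrow> (real ^ 'n) set" where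
  "null_space M = {x. M *v x = 0}"

definition range_space :: "real ^ 'n ^ 'm \<Rightarrow> (real ^ 'm) set" where
  "range_space M = range (\<lambda>x. M *v x)"

definition fix_space :: "real ^ 'n ^ 'n \<Rightarrow> (real ^ 'n) set" where
  "fix_space M = {x. M *v x = x}"

definition ext_indicator :: "'a set \<Rightarrow> 'a \<Rightarrow> ereal" where
  "ext_indicator S x = (if x \<in> S then 0 else \<infinity>)"

definition sym_regularizer :: "real ^ 'n ^ 'n \<Rightarrow> real ^ 'n \<Rightarrow> ereal" where
  "sym_regularizer M x =
     ereal (1 / 2 * (x \<bullet> ((pinv M ** (mat 1 - M)) *v x))) + ext_indicator (range_space M) x"

definition regularizer :: "real ^ 'n ^ 'n \<Rightarrow> real ^ 'n \<Rightarrow> ereal" where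
  "regularizer K x = sym_regularizer (sym_denoiser K) (sqrt_deg_mat K *v x)"

definition least_squares_loss :: "real ^ 'n ^ 'm \<Rightarrow> real ^ 'm \<Rightarrow> real ^ 'n \<Rightarrow> real" where
  "least_squares_loss A b x = 1 / 2 * (norm (A *v x - b))\<^sup>2"

definition inner_wrt :: "real ^ 'n ^ 'n \<Rightarrow> real ^ 'n \<Rightarrow> real ^ 'n \<Rightarrow> real" where
  "inner_wrt D x y = x \<bullet> (D *v y)"

definition epi :: "('a \<Rightarrow> ereal) \<Rightarrow> ('a \<times> real) set" where
  "epi f = {(x, r). f x \<le> ereal r}"

definition proper_fun :: "('a \<Rightarrow> ereal) \<Rightarrow> bool" where
  "proper_fun f \<longleftrightarrow> (\<forall>x. f x \<noteq> -\<infinity>) \<and> (\<exists>x. f x \<noteq> \<infinity>)"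

(* Strong convexity for the norm sqrt (ip x x) induced by an inner product ip.
   Closedness is with respect to the usual topology, the one every inner product induces
   in finite dimension.  For t = 0 or t = 1 the library's convention 0 * \<infinity> = 0 applies,
   and the inequality is then trivial. *)
definition strongly_convex_fun ::
  "('a::euclidean_space \<Rightarrow> 'a \<Rightarrow> real) \<Rightarrow> ('a \<Rightarrow> ereal) \<Rightarrow> bool" where
  "strongly_convex_fun ip f \<longleftrightarrow>
     proper_fun f \<and> closed (epi f) \<and> convex (epi f) \<and>
     (\<exists>\<mu>>0. \<forall>x y. \<forall>t\<in>{0..1}.
        f (t *\<^sub>R x + (1 - t) *\<^sub>R y)
          \<le> ereal t * f x + ereal (1 - t) * f y
             - ereal (\<mu> / 2 * t * (1 - t) * (sqrt (ip (x - y) (x - y)))\<^sup>2))"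

end

theory Submission
  imports Defs
begin

text \<open>
  On the range of \<open>W\<^sub>s\<close>, writing \<open>y = W\<^sub>s z\<close>, the quadratic form of the regularizer is
  \<open>z \<bullet> (W\<^sub>s - W\<^sub>s\<^sup>2) z\<close>. The identity \<open>S - S\<^sup>2 = S (I - S) S + (I - S) S (I - S)\<close>
  and \<open>0 \<le> W\<^sub>s \<le> I\<close> show that this is at least \<open>y \<bullet> (I - W\<^sub>s) y\<close>, which for
  \<open>y = D\<^sup>1\<^sup>/\<^sup>2 x\<close> is the Laplacian form \<open>x \<bullet> (D - K) x\<close>. So the quadratic part of the objective
  is bounded below by a continuous quadratic form on the whole space whose zero set is
  \<open>N(A) \<inter> fix(W)\<close>; if that is trivial, compactness of the sphere yields the modulus.
  Conversely the objective is constant along \<open>N(A) \<inter> fix(W)\<close>.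
\<close>

section \<open>The Moore-Penrose pseudoinverse\<close>

lemma matrix_sub_ldistrib:
  fixes M :: "'a::ring_1 ^ 'n ^ 'm"
  shows "M ** (X - Y) = M ** X - M ** Y"
  by (vector matrix_matrix_mult_def sum_subtractf right_diff_distrib)

text \<open>Paired with \<open>Y *v x\<close>, the hypothesis says that \<open>(M ** Y) *v x\<close>
  has squared norm zero.\<close>

lemma transpose_mult_cancel:
  fixes M :: "real ^ 'n ^ 'm" and Y :: "real ^ 'k ^ 'n"
  assumes "transpose M ** (M ** Y) = 0"
  shows "M ** Y = 0"
proof -
  have "(M ** Y) *v x = 0" for x
  proof -
    have "((M ** Y) *v x) \<bullet> ((M ** Y) *v x) = (Y *v x) \<bullet> ((transpose M ** (M ** Y)) *v x)"
      by (simp add: matrix_vector_mul_assoc[symmetric] dot_lmul_matrix[symmetric]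
          transpose_matrix_vector inner_commute)
    then show ?thesis using assms by simp
  qed
  then show ?thesis by (simp add: matrix_eq)
qed

text \<open>A linear map has a linear right inverse on its range; G is the matrix of one.\<close>

lemma generalized_inverse_exists:
  fixes M :: "real ^ 'n ^ 'm"
  shows "\<exists>G. M ** G ** M = M"
proof -
  obtain g where g: "linear g" "\<forall>v\<in>range ((*v) M). M *v g v = v"
    using linear_exists_right_inverse_on[OF matrix_vector_mul_linear[of M] subspace_UNIV] by auto
  have "M ** matrix g ** M = M"
    using g by (auto simp: matrix_eq matrix_vector_mul_assoc[symmetric] matrix_works)
  then show ?thesis ..
qed

text \<open>Zlobec's formula: \<open>M\<^sup>T G M\<^sup>T\<close> with \<open>G\<close> a generalized inverse of \<open>M\<^sup>T M M\<^sup>T\<close>.\<close>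

lemma is_pinv_exists:
  fixes M :: "real ^ 'n ^ 'm"
  shows "\<exists>X. is_pinv M X"
proof -
  define N where "N = transpose M"
  have tN: "transpose N = M" "transpose M = N" by (simp_all add: N_def)
  obtain G where G: "(N ** M ** N) ** G ** (N ** M ** N) = N ** M ** N"
    using generalized_inverse_exists by blast
  define X where "X = N ** G ** N"
  \<comment> \<open>Kept generic because it is used twice: for G itself, and for the transposed
    equation with M and N exchanged.\<close>
  have *: "N ** G' ** N ** M ** N = N"
    if "(N ** M ** N) ** G' ** (N ** M ** N) = N ** M ** N"
      and tN: "transpose N = M" "transpose M = N"
    for G' :: "real ^ 'q ^ 'p" and N :: "real ^ 'p ^ 'q" and M :: "real ^ 'q ^ 'p"
  proof -
    \<comment> \<open>The claim is \<open>N ** Z = 0\<close>. The hypothesis gives this multiplied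
      on the left by \<open>N ** M\<close>, and these two factors cancel one at a time, each being
      the transpose of its right neighbour.\<close>
    define Z where "Z = G' ** N ** M ** N - mat 1"
    have "N ** (M ** (N ** Z)) = 0"
      using that(1) by (simp add: Z_def matrix_sub_ldistrib matrix_mul_assoc)
    then have "M ** (N ** Z) = 0"
      using transpose_mult_cancel[of M "N ** Z"] by (simp add: tN)
    then have "N ** Z = 0"
      using transpose_mult_cancel[of N Z] by (simp add: tN)
    then show ?thesis
      by (simp add: Z_def matrix_sub_ldistrib matrix_mul_assoc)
  qed
  have XMN: "X ** M ** N = N"
    unfolding X_def by (rule *[OF G tN])
  have "(M ** N ** M) ** transpose G ** (M ** N ** M) = M ** N ** M"
    using arg_cong[OF G, of transpose] by (simp add: matrix_transpose_mul tN matrix_mul_assoc)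
  from *[OF this tN(2,1)] have "M ** transpose G ** M ** N ** M = M" .
  from arg_cong[OF this, of transpose] have NMX: "N ** M ** X = N"
    by (simp add: X_def matrix_transpose_mul tN matrix_mul_assoc)
  \<comment> \<open>Hence \<open>X ** M\<close> equals its product with its own transpose, which is
    symmetric. The same argument from \<open>NMX\<close> treats \<open>M ** X\<close>.\<close>
  have 1: "M ** transpose (X ** M) = M"
    using arg_cong[OF XMN, of transpose] by (simp add: matrix_transpose_mul tN matrix_mul_assoc)
  then have "X ** M ** transpose (X ** M) = X ** M"
    by (simp add: matrix_mul_assoc[symmetric])
  then have symXM: "transpose (X ** M) = X ** M"
    by (metis matrix_transpose_mul transpose_transpose)
  have 2: "transpose (M ** X) ** M = M"
    using arg_cong[OF NMX, of transpose] by (simp add: matrix_transpose_mul tN matrix_mul_assoc)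
  then have "transpose (M ** X) ** (M ** X) = M ** X"
    by (simp add: matrix_mul_assoc)
  then have symMX: "transpose (M ** X) = M ** X"
    by (metis matrix_transpose_mul transpose_transpose)
  have "X ** M ** X = X ** M ** N ** G ** N"
    by (simp add: X_def matrix_mul_assoc)
  then have "X ** M ** X = X"
    by (simp add: XMN) (simp add: X_def)
  with symXM symMX 2 have "is_pinv M X"
    by (simp add: is_pinv_def)
  then show ?thesis ..
qed

text \<open>Symmetry of the products forces \<open>M ** X = M ** Y\<close> and
  \<open>X ** M = Y ** M\<close>; then X = XMX = XMY = YMY = Y.\<close>

lemma is_pinv_unique:
  assumes "is_pinv M X" "is_pinv M Y"
  shows "X = Y"
proof -
  note X = assms(1)[unfolded is_pinv_def] and Y = assms(2)[unfolded is_pinv_def]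
  have "M ** X = transpose (M ** Y) ** transpose (M ** X)"
    using X Y by (metis matrix_mul_assoc)
  also have "\<dots> = transpose (M ** X ** M ** Y)"
    by (simp add: matrix_transpose_mul matrix_mul_assoc)
  finally have MX: "M ** X = M ** Y" using X Y by simp
  have "X ** M = transpose (X ** M) ** transpose (Y ** M)"
    using X Y by (metis matrix_mul_assoc)
  also have "\<dots> = transpose (Y ** M ** X ** M)"
    by (simp add: matrix_transpose_mul matrix_mul_assoc)
  finally have XM: "X ** M = Y ** M" using X Y by (metis matrix_mul_assoc)
  show ?thesis using X Y MX XM by (metis matrix_mul_assoc)
qed

lemma is_pinv_pinv: "is_pinv M (pinv M)"
  unfolding pinv_def
  using is_pinv_exists is_pinv_unique by (metis theI)

lemma mult_pinv_mult: "M ** pinv M ** M = M"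
  using is_pinv_pinv[of M] by (simp add: is_pinv_def)

section \<open>The quadratic form of the regularizer\<close>

lemma inner_symmetric_matrix:
  fixes M :: "real ^ 'n ^ 'n"
  assumes "transpose M = M"
  shows "x \<bullet> (M *v y) = (M *v x) \<bullet> y"
  using assms by (metis dot_lmul_matrix transpose_matrix_vector)

text \<open>For any preimage z of y under S, the difference of the two sides is the S-form at
  \<open>z - y\<close>. This trades the pseudoinverse for the form of I - S, which will be positive
  off the fixed space.\<close>

lemma pinv_form_ge:
  fixes S :: "real ^ 'n ^ 'n"
  assumes S: "psd_matrix S" and le: "\<And>u. u \<bullet> (S *v u) \<le> u \<bullet> u" and y: "y \<in> range_space S"
  shows "y \<bullet> y - y \<bullet> (S *v y) \<le> y \<bullet> ((pinv S ** (mat 1 - S)) *v y)"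
proof -
  obtain z where z: "y = S *v z" using y by (auto simp: range_space_def)
  have tS: "transpose S = S" and pos: "\<And>u. 0 \<le> u \<bullet> (S *v u)"
    using S by (auto simp: psd_matrix_def)
  note sym = inner_symmetric_matrix[OF tS]
  have SPS: "S *v (pinv S *v (S *v v)) = S *v v" for v
    using mult_pinv_mult[of S] by (metis matrix_vector_mul_assoc)
  \<comment> \<open>Moving the S of \<open>y = S *v z\<close> across the inner product creates
    \<open>S ** pinv S ** S\<close>, which collapses to S.\<close>
  have "y \<bullet> ((pinv S ** (mat 1 - S)) *v y) = z \<bullet> (S *v z) - z \<bullet> (S *v y)"
    by (simp add: z matrix_vector_mul_assoc[symmetric] matrix_vector_mult_diff_rdistrib
        matrix_vector_mult_diff_distrib sym[symmetric] SPS inner_diff_right)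
  also have "\<dots> = (y \<bullet> y - y \<bullet> (S *v y)) + (z - y) \<bullet> (S *v (z - y))"
    using z by (simp add: matrix_vector_mult_diff_distrib inner_diff)
  finally show ?thesis using pos[of "z - y"] by simp
qed

section \<open>Strong convexity of quadratic functions on a subspace\<close>

text \<open>Both sides scale by the square of the norm, so it suffices to compare the minimum of q
  with the maximum of p on the compact unit sphere.\<close>

lemma homogeneous_bound:
  fixes p q :: "'a::euclidean_space \<Rightarrow> real"
  assumes cont: "continuous_on UNIV p" "continuous_on UNIV q"
    and hom: "\<And>c x. p (c *\<^sub>R x) = c\<^sup>2 * p x" "\<And>c x. q (c *\<^sub>R x) = c\<^sup>2 * q x"
    and pos: "\<And>x. x \<noteq> 0 \<Longrightarrow> 0 < q x"
  shows "\<exists>\<mu>>0. \<forall>x. \<mu> * p x \<le> q x"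
proof -
  let ?S = "sphere 0 1 :: 'a set"
  have S: "compact ?S" "?S \<noteq> {}" by auto
  obtain u where u: "u \<in> ?S" "\<forall>v\<in>?S. q u \<le> q v"
    using continuous_attains_inf[OF S continuous_on_subset[OF cont(2)]] by auto
  obtain w where w: "w \<in> ?S" "\<forall>v\<in>?S. p v \<le> p w"
    using continuous_attains_sup[OF S continuous_on_subset[OF cont(1)]] by auto
  have qu: "0 < q u" using u(1) by (intro pos) auto
  \<comment> \<open>The absolute value and the 1 keep the denominator positive whatever the sign of
    p.\<close>
  define \<mu> where "\<mu> = q u / (\<bar>p w\<bar> + 1)"
  have \<mu>: "0 < \<mu>" using qu by (simp add: \<mu>_def add_nonneg_pos)
  have sph: "\<mu> * p v \<le> q v" if "v \<in> ?S" for v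
  proof -
    have "p v \<le> \<bar>p w\<bar> + 1" using w(2) that by fastforce
    then have "\<mu> * p v \<le> \<mu> * (\<bar>p w\<bar> + 1)" using \<mu> by simp
    also have "\<dots> = q u" by (simp add: \<mu>_def field_simps add_nonneg_eq_0_iff)
    also have "\<dots> \<le> q v" using u(2) that by blast
    finally show ?thesis .
  qed
  have "\<mu> * p x \<le> q x" for x
  proof (cases "x = 0")
    case True
    then show ?thesis using hom[of 0 x] by simp
  next
    case False
    define v where "v = inverse (norm x) *\<^sub>R x"
    have v: "v \<in> ?S" and x: "x = norm x *\<^sub>R v" using False by (auto simp: v_def)
    have "\<mu> * p x = (norm x)\<^sup>2 * (\<mu> * p v)" by (subst x) (simp add: hom)
    also have "\<dots> \<le> (norm x)\<^sup>2 * q v" using sph[OF v] by (simp add: mult_left_mono)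
    also have "\<dots> = q x" using hom(2)[of "norm x" v] by (simp flip: x)
    finally show ?thesis .
  qed
  with \<mu> show ?thesis by blast
qed

text \<open>The convexity gap of a quadratic is exactly \<open>t * (1 - t) * Q (x - y)\<close>, and
  \<open>x - y\<close> stays in V, so a lower bound for Q on V is a modulus. Closedness holds
  because V is closed and F is continuous.\<close>

lemma strongly_convex_fun_on_subspace:
  fixes F :: "'a::euclidean_space \<Rightarrow> real"
  assumes V: "subspace V" and cont: "continuous_on UNIV F"
    and quad: "\<And>x y t. F (t *\<^sub>R x + (1 - t) *\<^sub>R y)
      = t * F x + (1 - t) * F y - t * (1 - t) * Q (x - y)"
    and "\<mu> > 0" and low: "\<And>z. z \<in> V \<Longrightarrow> \<mu> / 2 * ip z z \<le> Q z" and ip: "\<And>z. 0 \<le> ip z z"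
  shows "strongly_convex_fun ip (\<lambda>x. if x \<in> V then ereal (F x) else \<infinity>)"
    (is "strongly_convex_fun ip ?f")
proof -
  have epi: "epi ?f = (V \<times> UNIV) \<inter> {p. F (fst p) \<le> snd p}"
    by (auto simp: epi_def split: if_splits)
  have comb: "t *\<^sub>R x + (1 - t) *\<^sub>R y \<in> V" if "x \<in> V" "y \<in> V" for x y t
    using V that by (simp add: subspace_add subspace_scale)
  have sc: "F (t *\<^sub>R x + (1 - t) *\<^sub>R y) \<le> t * F x + (1 - t) * F y - \<mu> / 2 * t * (1 - t) * ip (x - y) (x - y)"
    if "x \<in> V" "y \<in> V" "t \<in> {0..1}" for x y t
  proof -
    have "t * (1 - t) * (\<mu> / 2 * ip (x - y) (x - y)) \<le> t * (1 - t) * Q (x - y)"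
      using that V low[of "x - y"] by (intro mult_left_mono) (auto simp: subspace_diff)
    then show ?thesis unfolding quad by (simp add: algebra_simps)
  qed
  have "proper_fun ?f"
    using subspace_0[OF V] by (auto simp: proper_fun_def)
  moreover have "closed (epi ?f)"
  proof -
    have "continuous_on UNIV (\<lambda>p::'a \<times> real. F (fst p))"
      by (rule continuous_on_compose2[OF cont]) (auto intro: continuous_intros)
    then have "closed {p::'a \<times> real. F (fst p) \<le> snd p}"
      by (intro closed_Collect_le) (auto intro: continuous_intros)
    then show ?thesis
      unfolding epi by (intro closed_Int closed_Times closed_subspace[OF V] closed_UNIV)
  qed
  moreover have "convex (epi ?f)"
    unfolding convex_alt epi
  proof (intro ballI allI impI)
    fix a c :: "'a \<times> real" and u :: real
    assume ac: "a \<in> V \<times> UNIV \<inter> {p. F (fst p) \<le> snd p}" "c \<in> V \<times> UNIV \<inter> {p. F (fst p) \<le> snd p}"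
      and "0 \<le> u \<and> u \<le> 1"
    then have u: "0 \<le> u" "u \<le> 1" by auto
    obtain x r y s where [simp]: "a = (x, r)" "c = (y, s)" by (cases a, cases c)
    have xy: "x \<in> V" "F x \<le> r" "y \<in> V" "F y \<le> s" using ac by auto
    have "F ((1 - u) *\<^sub>R x + u *\<^sub>R y) \<le> (1 - u) * F x + u * F y - \<mu> / 2 * (1 - u) * u * ip (x - y) (x - y)"
      using sc[of x y "1 - u"] xy u by simp
    also have "\<dots> \<le> (1 - u) * F x + u * F y"
      using \<open>\<mu> > 0\<close> u ip[of "x - y"] by simp
    also have "\<dots> \<le> (1 - u) * r + u * s"
      using xy u by (intro add_mono mult_left_mono) auto
    finally show "(1 - u) *\<^sub>R a + u *\<^sub>R c \<in> V \<times> UNIV \<inter> {p. F (fst p) \<le> snd p}"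
      using comb[of x y "1 - u"] xy by simp
  qed
  moreover have "?f (t *\<^sub>R x + (1 - t) *\<^sub>R y)
      \<le> ereal t * ?f x + ereal (1 - t) * ?f y
         - ereal (\<mu> / 2 * t * (1 - t) * (sqrt (ip (x - y) (x - y)))\<^sup>2)"
    if t: "t \<in> {0..1}" for x y t
  proof -
    \<comment> \<open>At the endpoints an infinite value may be multiplied by 0, which gives 0; only
      for t strictly between does a point off V make the right side infinite.\<close>
    consider "t = 0" | "t = 1" | "0 < t" "t < 1" "x \<notin> V \<or> y \<notin> V" | "x \<in> V" "y \<in> V"
      using t by fastforce
    then show ?thesis
    proof cases
      case 3
      then have "ereal t * ?f x + ereal (1 - t) * ?f y = \<infinity>" by auto
      then show ?thesis by (simp only: ereal_minus_eq_PInfty_iff ereal.distinct ereal_less_eq) simp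
    next
      case 4
      then show ?thesis using sc[OF 4 t] ip[of "x - y"] comb[OF 4] by simp
    qed (simp_all add: zero_ereal_def[symmetric] one_ereal_def[symmetric])
  qed
  ultimately show ?thesis
    unfolding strongly_convex_fun_def using \<open>\<mu> > 0\<close> by blast
qed

text \<open>The two cross terms cancel separately, so M can be \<open>pinv S ** (mat 1 - S)\<close>
  as it stands.\<close>

lemma quadratic_form_combination:
  fixes M :: "real ^ 'n ^ 'n"
  shows "(t *\<^sub>R x + (1 - t) *\<^sub>R y) \<bullet> (M *v (t *\<^sub>R x + (1 - t) *\<^sub>R y))
    = t * (x \<bullet> (M *v x)) + (1 - t) * (y \<bullet> (M *v y)) - t * (1 - t) * ((x - y) \<bullet> (M *v (x - y)))"
  by (simp add: matrix_vector_right_distrib matrix_vector_mult_diff_distrib matrix_vector_mult_scaleR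
      inner_simps) (simp add: algebra_simps)

lemma least_squares_combination:
  "least_squares_loss A b (t *\<^sub>R x + (1 - t) *\<^sub>R y)
    = t * least_squares_loss A b x + (1 - t) * least_squares_loss A b y
      - t * (1 - t) * (1 / 2 * (norm (A *v (x - y)))\<^sup>2)"
proof -
  \<comment> \<open>The weights add up to 1, so the residuals combine like the points, and b drops
    out of their difference.\<close>
  define p q where "p = A *v x - b" "q = A *v y - b"
  have "A *v (t *\<^sub>R x + (1 - t) *\<^sub>R y) - b = t *\<^sub>R p + (1 - t) *\<^sub>R q" "A *v (x - y) = p - q"
    by (simp_all add: p_q_def matrix_vector_right_distrib matrix_vector_mult_diff_distrib
        matrix_vector_mult_scaleR algebra_simps)
  then show ?thesis
    unfolding least_squares_loss_def p_q_def(1,2)[symmetric]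
    by (simp add: power2_norm_eq_inner inner_simps inner_commute[of q p]) (simp add: algebra_simps)
qed

section \<open>The degree matrix and the graph Laplacian\<close>

lemma diag_mat_vector: "(diag_mat v *v x) $ i = v $ i * x $ i"
  by (simp add: diag_mat_def matrix_vector_mult_def if_distrib[of "\<lambda>c. c * _"] cong: if_cong)

lemma transpose_diag_mat: "transpose (diag_mat v) = diag_mat v"
  by (auto simp: diag_mat_def transpose_def vec_eq_iff)

lemma diag_mat_inverse:
  assumes "\<And>i. v $ i \<noteq> 0"
  shows "diag_mat v *v (matrix_inv (diag_mat v) *v x) = x"
    and "matrix_inv (diag_mat v) *v (diag_mat v *v x) = x"
    and "transpose (matrix_inv (diag_mat v)) = matrix_inv (diag_mat v)"
proof -
  let ?J = "diag_mat (\<chi> i. inverse (v $ i))"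
  have J: "diag_mat v ** ?J = mat 1" "?J ** diag_mat v = mat 1"
    using assms by (simp_all add: matrix_eq matrix_vector_mul_assoc[symmetric] vec_eq_iff diag_mat_vector)
  \<comment> \<open>\<open>matrix_inv\<close> is a choice among two-sided inverses, so uniqueness
    identifies it.\<close>
  have inv: "matrix_inv (diag_mat v) = ?J"
    unfolding matrix_inv_def
  proof (rule some_equality)
    show "Y = ?J" if "diag_mat v ** Y = mat 1 \<and> Y ** diag_mat v = mat 1" for Y
      using that J by (metis matrix_mul_assoc matrix_mul_lid matrix_mul_rid)
  qed (use J in simp)
  show "diag_mat v *v (matrix_inv (diag_mat v) *v x) = x"
    "matrix_inv (diag_mat v) *v (diag_mat v *v x) = x"
    by (simp_all add: inv matrix_vector_mul_assoc J)
  show "transpose (matrix_inv (diag_mat v)) = matrix_inv (diag_mat v)"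
    by (simp add: inv transpose_diag_mat)
qed

lemma row_sums_nth: "row_sums K $ i = (\<Sum>j\<in>UNIV. K $ i $ j)"
  by (simp add: row_sums_def matrix_vector_mult_def)

lemma kernel_matrix_row_sums_pos:
  assumes "kernel_matrix K"
  shows "0 < row_sums K $ i"
proof -
  have "0 < K $ i $ i" "\<And>j. 0 \<le> K $ i $ j" using assms by (auto simp: kernel_matrix_def)
  then show ?thesis unfolding row_sums_nth by (intro sum_pos2[of _ i]) auto
qed

lemma deg_mat_sqrt:
  assumes "kernel_matrix K"
  shows "sqrt_deg_mat K *v (sqrt_deg_mat K *v x) = deg_mat K *v x"
  using kernel_matrix_row_sums_pos[OF assms]
  by (simp add: vec_eq_iff sqrt_deg_mat_def deg_mat_def diag_mat_vector less_imp_le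
      flip: mult.assoc)

text \<open>The Dirichlet energy of the graph with edge weights K. In the expanded square, both pure
  terms sum to the degree form: the first by row sums, the second after exchanging i and j.\<close>

lemma laplacian_form:
  fixes K :: "real ^ 'n ^ 'n"
  assumes "transpose K = K"
  shows "2 * (x \<bullet> (deg_mat K *v x) - x \<bullet> (K *v x))
    = (\<Sum>i\<in>UNIV. \<Sum>j\<in>UNIV. K $ i $ j * (x $ i - x $ j)\<^sup>2)"
proof -
  have sym: "K $ i $ j = K $ j $ i" for i j
    using assms by (metis transpose_def vec_lambda_beta)
  have D: "x \<bullet> (deg_mat K *v x) = (\<Sum>i\<in>UNIV. \<Sum>j\<in>UNIV. K $ i $ j * (x $ i)\<^sup>2)"
    by (simp add: inner_vec_def deg_mat_def diag_mat_vector row_sums_nth power2_eq_square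
        mult.left_commute[of "x $ _"] flip: sum_distrib_right)
  have D': "x \<bullet> (deg_mat K *v x) = (\<Sum>i\<in>UNIV. \<Sum>j\<in>UNIV. K $ i $ j * (x $ j)\<^sup>2)"
    unfolding D by (subst sum.swap) (rule sum.cong[OF refl], rule sum.cong[OF refl], subst sym, rule refl)
  have "x \<bullet> (K *v x) = (\<Sum>i\<in>UNIV. \<Sum>j\<in>UNIV. K $ i $ j * (x $ i * x $ j))"
    by (simp add: inner_vec_def matrix_vector_mult_def sum_distrib_left mult_ac)
  moreover have "(\<Sum>i\<in>UNIV. \<Sum>j\<in>UNIV. K $ i $ j * (x $ i - x $ j)\<^sup>2)
    = (\<Sum>i\<in>UNIV. \<Sum>j\<in>UNIV. K $ i $ j * (x $ i)\<^sup>2) + (\<Sum>i\<in>UNIV. \<Sum>j\<in>UNIV. K $ i $ j * (x $ j)\<^sup>2)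
      - 2 * (\<Sum>i\<in>UNIV. \<Sum>j\<in>UNIV. K $ i $ j * (x $ i * x $ j))"
    by (simp add: sum_distrib_left power2_diff algebra_simps sum.distrib sum_subtractf)
  ultimately show ?thesis using D D' by simp
qed

lemma laplacian_nonneg:
  assumes "kernel_matrix K"
  shows "x \<bullet> (K *v x) \<le> x \<bullet> (deg_mat K *v x)"
proof -
  have "0 \<le> 2 * (x \<bullet> (deg_mat K *v x) - x \<bullet> (K *v x))"
    using assms by (subst laplacian_form)
      (auto simp: kernel_matrix_def psd_matrix_def intro!: sum_nonneg)
  then show ?thesis by simp
qed

text \<open>A sum of nonnegative terms vanishes, so x takes equal values at i and j wherever the
  weight is nonzero; row i of \<open>K *v x\<close> is then \<open>x $ i\<close> times the row
  sum.\<close>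

lemma laplacian_zero:
  assumes K: "kernel_matrix K" and eq: "x \<bullet> (K *v x) = x \<bullet> (deg_mat K *v x)"
  shows "K *v x = deg_mat K *v x"
proof -
  have nn: "0 \<le> K $ i $ j * (x $ i - x $ j)\<^sup>2" for i j
    using K by (auto simp: kernel_matrix_def)
  have "(\<Sum>i\<in>UNIV. \<Sum>j\<in>UNIV. K $ i $ j * (x $ i - x $ j)\<^sup>2) = 0"
    using laplacian_form[of K x] K eq by (simp add: kernel_matrix_def psd_matrix_def)
  then have "K $ i $ j * (x $ i - x $ j)\<^sup>2 = 0" for i j
    using nn by (simp add: sum_nonneg_eq_0_iff sum_nonneg)
  then have "K $ i $ j * x $ j = K $ i $ j * x $ i" for i j
    by (metis eq_iff_diff_eq_0 mult_eq_0_iff power_eq_0_iff)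
  then have "(\<Sum>j\<in>UNIV. K $ i $ j * x $ j) = (\<Sum>j\<in>UNIV. K $ i $ j * x $ i)" for i
    by (rule sum.cong[OF refl])
  then have "(K *v x) $ i = (\<Sum>j\<in>UNIV. K $ i $ j * x $ i)" for i
    by (simp only: matrix_vector_mult_def vec_lambda_beta)
  then show ?thesis
    by (simp add: vec_eq_iff deg_mat_def diag_mat_vector row_sums_nth sum_distrib_right)
qed

text \<open>D is invertible because its diagonal is positive. Thus fix(W) is the null space of the
  Laplacian D - K.\<close>

lemma fix_space_kernel_denoiser:
  assumes "kernel_matrix K"
  shows "x \<in> fix_space (kernel_denoiser K) \<longleftrightarrow> K *v x = deg_mat K *v x"
proof -
  have "row_sums K $ i \<noteq> 0" for i using kernel_matrix_row_sums_pos[OF assms, of i] by simp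
  from diag_mat_inverse(1,2)[of "row_sums K", OF this] show ?thesis
    by (auto simp: fix_space_def kernel_denoiser_def deg_mat_def matrix_vector_mul_assoc[symmetric])
       metis
qed

section \<open>The symmetrized denoiser\<close>

context
  fixes K :: "real ^ 'n ^ 'n"
  assumes K: "kernel_matrix K"
begin

lemma sqrt_deg_mat_inverse:
  "sqrt_deg_mat K *v (matrix_inv (sqrt_deg_mat K) *v x) = x"
  "matrix_inv (sqrt_deg_mat K) *v (sqrt_deg_mat K *v x) = x"
  "transpose (matrix_inv (sqrt_deg_mat K)) = matrix_inv (sqrt_deg_mat K)"
proof -
  have "(\<chi> i. sqrt (row_sums K $ i)) $ i \<noteq> 0" for i
    using kernel_matrix_row_sums_pos[OF K, of i] by simp
  from diag_mat_inverse[of "\<chi> i. sqrt (row_sums K $ i)", OF this]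
  show "sqrt_deg_mat K *v (matrix_inv (sqrt_deg_mat K) *v x) = x"
    "matrix_inv (sqrt_deg_mat K) *v (sqrt_deg_mat K *v x) = x"
    "transpose (matrix_inv (sqrt_deg_mat K)) = matrix_inv (sqrt_deg_mat K)"
    by (simp_all add: sqrt_deg_mat_def)
qed

lemma transpose_sqrt_deg_mat: "transpose (sqrt_deg_mat K) = sqrt_deg_mat K"
  by (simp add: sqrt_deg_mat_def transpose_diag_mat)

lemma sym_denoiser_sqrt_deg:
  "sym_denoiser K *v (sqrt_deg_mat K *v x) = matrix_inv (sqrt_deg_mat K) *v (K *v x)"
  by (simp add: sym_denoiser_def matrix_vector_mul_assoc[symmetric] sqrt_deg_mat_inverse)

text \<open>With \<open>sqrt_deg_mat_form\<close>, this carries inequalities between K and D over to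
  W_s and I by the invertible substitution u = D^(1/2) x.\<close>

lemma sym_denoiser_form:
  "(sqrt_deg_mat K *v x) \<bullet> (sym_denoiser K *v (sqrt_deg_mat K *v x)) = x \<bullet> (K *v x)"
  by (simp add: sym_denoiser_sqrt_deg inner_symmetric_matrix[OF transpose_sqrt_deg_mat, symmetric]
      sqrt_deg_mat_inverse)

lemma sqrt_deg_mat_form:
  "(sqrt_deg_mat K *v x) \<bullet> (sqrt_deg_mat K *v x) = x \<bullet> (deg_mat K *v x)"
  by (simp add: inner_symmetric_matrix[OF transpose_sqrt_deg_mat, symmetric] deg_mat_sqrt[OF K])

lemma psd_sym_denoiser: "psd_matrix (sym_denoiser K)"
proof -
  have "transpose (sym_denoiser K) = sym_denoiser K"
    using K by (simp add: sym_denoiser_def matrix_transpose_mul sqrt_deg_mat_inverse(3)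
        matrix_mul_assoc kernel_matrix_def psd_matrix_def)
  moreover have "0 \<le> u \<bullet> (sym_denoiser K *v u)" for u
    using sym_denoiser_form[of "matrix_inv (sqrt_deg_mat K) *v u"] K
    by (simp add: sqrt_deg_mat_inverse kernel_matrix_def psd_matrix_def)
  ultimately show ?thesis by (simp add: psd_matrix_def)
qed

lemma sym_denoiser_le: "u \<bullet> (sym_denoiser K *v u) \<le> u \<bullet> u"
  using sym_denoiser_form[of "matrix_inv (sqrt_deg_mat K) *v u"]
    sqrt_deg_mat_form[of "matrix_inv (sqrt_deg_mat K) *v u"] laplacian_nonneg[OF K]
  by (simp add: sqrt_deg_mat_inverse)

text \<open>D^(1/2) x is fixed by W_s, hence lies in its range and is annihilated by I -
  W_s.\<close>

lemma regularizer_fix_space: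
  assumes "x \<in> fix_space (kernel_denoiser K)"
  shows "regularizer K x = 0"
proof -
  let ?y = "sqrt_deg_mat K *v x"
  have "K *v x = sqrt_deg_mat K *v ?y"
    using assms by (simp add: fix_space_kernel_denoiser[OF K] deg_mat_sqrt[OF K])
  then have y: "sym_denoiser K *v ?y = ?y"
    by (simp add: sym_denoiser_sqrt_deg sqrt_deg_mat_inverse)
  then have "?y \<in> range_space (sym_denoiser K)"
    unfolding range_space_def by (metis rangeI)
  moreover have "(pinv (sym_denoiser K) ** (mat 1 - sym_denoiser K)) *v ?y = 0"
    by (simp add: matrix_vector_mul_assoc[symmetric] matrix_vector_mult_diff_rdistrib y)
  ultimately show ?thesis
    by (simp add: regularizer_def sym_regularizer_def ext_indicator_def)
qed

end

section \<open>The two implications and the equivalence\<close>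

lemma strongly_convex_imp_trivial:
  assumes K: "kernel_matrix K"
    and sc: "strongly_convex_fun (inner_wrt (deg_mat K))
      (\<lambda>x. ereal (least_squares_loss A b x) + ereal lam * regularizer K x)"
    and x: "x \<in> null_space A \<inter> fix_space (kernel_denoiser K)"
  shows "x = 0"
proof -
  let ?f = "\<lambda>x. ereal (least_squares_loss A b x) + ereal lam * regularizer K x"
  have val: "?f (c *\<^sub>R x) = ereal (1 / 2 * (norm b)\<^sup>2)" for c
  proof -
    have "c *\<^sub>R x \<in> fix_space (kernel_denoiser K)" "A *v (c *\<^sub>R x) = 0"
      using x by (auto simp: fix_space_def null_space_def matrix_vector_mult_scaleR)
    then show ?thesis
      by (simp add: regularizer_fix_space[OF K] least_squares_loss_def)
  qed
  obtain \<mu> where \<mu>: "\<mu> > 0" and ineq: "\<And>x y t. t \<in> {0..1} \<Longrightarrow>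
      ?f (t *\<^sub>R x + (1 - t) *\<^sub>R y) \<le> ereal t * ?f x + ereal (1 - t) * ?f y
        - ereal (\<mu> / 2 * t * (1 - t) * (sqrt (inner_wrt (deg_mat K) (x - y) (x - y)))\<^sup>2)"
    using sc unfolding strongly_convex_fun_def by blast
  let ?p = "x \<bullet> (deg_mat K *v x)"
  have p: "?p = (sqrt_deg_mat K *v x) \<bullet> (sqrt_deg_mat K *v x)"
    by (simp add: sqrt_deg_mat_form[OF K])
  then have "0 \<le> ?p" by simp
  \<comment> \<open>The midpoint of x and 0: all three values of the objective agree, leaving only
    the modulus term.\<close>
  have "\<mu> * ?p \<le> 0"
    using ineq[of "1/2" x 0] val[of "1/2"] val[of 1] val[of 0] \<open>0 \<le> ?p\<close>
    by (simp add: inner_wrt_def field_simps)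
  then have "?p = 0" using \<mu> \<open>0 \<le> ?p\<close> by (simp add: mult_le_0_iff)
  then have "sqrt_deg_mat K *v x = 0" using p by simp
  then show ?thesis using sqrt_deg_mat_inverse(2)[OF K, of x] by simp
qed

lemma trivial_imp_strongly_convex:
  fixes A :: "real ^ 'n ^ 'm" and K :: "real ^ 'n ^ 'n"
  assumes K: "kernel_matrix K" and lam: "lam > 0"
    and triv: "null_space A \<inter> fix_space (kernel_denoiser K) \<subseteq> {0}"
  shows "strongly_convex_fun (inner_wrt (deg_mat K))
    (\<lambda>x. ereal (least_squares_loss A b x) + ereal lam * regularizer K x)"
proof -
  let ?E = "sqrt_deg_mat K" and ?S = "sym_denoiser K" and ?D = "deg_mat K"
  let ?B = "pinv ?S ** (mat 1 - ?S)"
  \<comment> \<open>V is the effective domain, F the objective on it, Q the second-order part of F.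
    R puts the Laplacian in place of the pseudoinverse form: it bounds Q from below on V, yet is
    positive definite on the whole space.\<close>
  define V where "V = {x. ?E *v x \<in> range_space ?S}"
  define q where "q x = 1 / 2 * ((?E *v x) \<bullet> (?B *v (?E *v x)))" for x
  define F where "F x = least_squares_loss A b x + lam * q x" for x
  define Q where "Q x = 1 / 2 * (norm (A *v x))\<^sup>2 + lam * q x" for x
  define R where "R x = 1 / 2 * (norm (A *v x))\<^sup>2 + lam * (1 / 2 * (x \<bullet> (?D *v x) - x \<bullet> (K *v x)))" for x
  have "subspace (range_space ?S)"
    unfolding range_space_def by (intro linear_subspace_image) auto
  then have V: "subspace V"
    unfolding V_def by (intro linear_subspace_linear_preimage[where f = "(*v) ?E"]) auto
  have R_le_Q: "R x \<le> Q x" if "x \<in> V" for x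
  proof -
    have "x \<bullet> (?D *v x) - x \<bullet> (K *v x) \<le> (?E *v x) \<bullet> (?B *v (?E *v x))"
      using pinv_form_ge[OF psd_sym_denoiser[OF K] sym_denoiser_le[OF K], of "?E *v x"] that
      by (simp add: V_def sqrt_deg_mat_form[OF K] sym_denoiser_form[OF K])
    then show ?thesis using lam by (simp add: R_def Q_def q_def)
  qed
  have "0 < R x" if "x \<noteq> 0" for x
  proof (rule ccontr)
    assume "\<not> 0 < R x"
    moreover have L: "0 \<le> x \<bullet> (?D *v x) - x \<bullet> (K *v x)"
      using laplacian_nonneg[OF K, of x] by simp
    moreover have "0 \<le> lam * (1 / 2 * (x \<bullet> (?D *v x) - x \<bullet> (K *v x)))"
      using lam L by (intro mult_nonneg_nonneg) auto
    moreover have "0 \<le> (norm (A *v x))\<^sup>2" by simp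
    ultimately have "(norm (A *v x))\<^sup>2 = 0" "lam * (1 / 2 * (x \<bullet> (?D *v x) - x \<bullet> (K *v x))) = 0"
      unfolding R_def by linarith+
    then have "A *v x = 0" "K *v x = ?D *v x"
      using lam laplacian_zero[OF K, of x] by auto
    then show False
      using triv that by (auto simp: null_space_def fix_space_kernel_denoiser[OF K])
  qed
  moreover have "continuous_on UNIV (\<lambda>x. x \<bullet> (?D *v x))" "continuous_on UNIV R"
    unfolding R_def by (intro continuous_intros matrix_vector_mult_linear_continuous_on)+
  moreover have "R (c *\<^sub>R x) = c\<^sup>2 * R x" for c x
    by (simp add: R_def matrix_vector_mult_scaleR power_mult_distrib power2_eq_square[of c] algebra_simps)
  moreover have "(c *\<^sub>R x) \<bullet> (?D *v (c *\<^sub>R x)) = c\<^sup>2 * (x \<bullet> (?D *v x))" for c x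
    by (simp add: matrix_vector_mult_scaleR power2_eq_square)
  ultimately obtain \<mu> where \<mu>: "\<mu> > 0" "\<And>x. \<mu> * (x \<bullet> (?D *v x)) \<le> R x"
    using homogeneous_bound[of "\<lambda>x. x \<bullet> (?D *v x)" R] by blast
  have "strongly_convex_fun (inner_wrt ?D) (\<lambda>x. if x \<in> V then ereal (F x) else \<infinity>)"
  \<comment> \<open>The 2 absorbs the 1/2 in the definition of the modulus.\<close>
  proof (rule strongly_convex_fun_on_subspace[OF V, where \<mu> = "2 * \<mu>" and Q = Q])
    show "continuous_on UNIV F"
      unfolding F_def q_def least_squares_loss_def
      by (intro continuous_intros matrix_vector_mult_linear_continuous_on
          linear_continuous_on_compose[where f = "\<lambda>x. ?E *v x"])
         auto
    show "F (t *\<^sub>R x + (1 - t) *\<^sub>R y) = t * F x + (1 - t) * F y - t * (1 - t) * Q (x - y)" for x y t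
    proof -
      have "q (t *\<^sub>R x + (1 - t) *\<^sub>R y) = t * q x + (1 - t) * q y - t * (1 - t) * q (x - y)"
        using quadratic_form_combination[of t "?E *v x" "?E *v y" ?B]
        unfolding q_def by (simp only: matrix_vector_right_distrib[of ?E]
            matrix_vector_mult_diff_distrib[of ?E] matrix_vector_mult_scaleR[of ?E])
          (simp only: right_diff_distrib distrib_left mult.left_commute)
      then show ?thesis
        unfolding F_def Q_def least_squares_combination by (simp only:) (simp add: algebra_simps)
    qed
    show "2 * \<mu> / 2 * inner_wrt ?D z z \<le> Q z" if "z \<in> V" for z
      using \<mu>(2)[of z] R_le_Q[OF that] by (simp add: inner_wrt_def)
    show "0 \<le> inner_wrt ?D z z" for z
      by (simp add: inner_wrt_def flip: sqrt_deg_mat_form[OF K])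
  qed (use \<mu> in auto)
  \<comment> \<open>Off V the indicator is infinite and stays so after scaling by the positive
    \<open>lam\<close>.\<close>
  also have "(\<lambda>x. if x \<in> V then ereal (F x) else \<infinity>)
      = (\<lambda>x. ereal (least_squares_loss A b x) + ereal lam * regularizer K x)"
    using lam by (auto simp: V_def F_def q_def regularizer_def sym_regularizer_def ext_indicator_def)
  finally show ?thesis .
qed

theorem theorem3p3:
  fixes A :: "real ^ 'n ^ 'm" and b :: "real ^ 'm"
    and K :: "real ^ 'n ^ 'n" and lam :: real
    and f :: "real ^ 'n \<Rightarrow> ereal"
  assumes "kernel_matrix K"
    and "lam > 0"
    and "f = (\<lambda>x. ereal (least_squares_loss A b x) + ereal lam * regularizer K x)"
  shows "strongly_convex_fun (inner_wrt (deg_mat K)) f \<longleftrightarrow>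
    null_space A \<inter> fix_space (kernel_denoiser K) = {0}"
proof
  assume "strongly_convex_fun (inner_wrt (deg_mat K)) f"
  moreover have "0 \<in> null_space A \<inter> fix_space (kernel_denoiser K)"
    by (simp add: null_space_def fix_space_def)
  ultimately show "null_space A \<inter> fix_space (kernel_denoiser K) = {0}"
    using strongly_convex_imp_trivial[OF assms(1)] unfolding assms(3) by blast
next
  assume "null_space A \<inter> fix_space (kernel_denoiser K) = {0}"
  then show "strongly_convex_fun (inner_wrt (deg_mat K)) f"
    unfolding assms(3) by (intro trivial_imp_strongly_convex assms) auto
qed

end
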